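(* Let $\Omega\subset\mathbb{H}^1$ be a bounded domain, $\varepsilon>0$, and $p,q\in(1,\infty)$ with $\frac1p+\frac1q=1$. For all $\psi\in L^p(\Omega)$ and $\phi\in L^q(\Omega\times Y)$, $$\int_\Omega\mathcal{U}_\varepsilon(\phi)(x)\,\psi(x)\,dx=\frac1{|Y|}\int_{\Omega\times Y}\phi(x,y)\,T^\varepsilon(\psi)(x,y)\,dx\,dy,$$ where $\mathcal{U}_\varepsilon$ is the averaging operator and $T^\varepsilon$ the unfolding operator.
   Context: $\mathbb{H}^1$ is $\mathbb{R}^3$ with the group law $p\cdot q=(p_1+q_1,p_2+q_2,p_3+q_3+2(p_2q_1-p_1q_2))$, inverse $x^{-1}=-x$, dilations $\delta_\lambda(x)=(\lambda x_1,\lambda x_2,\lambda^2x_3)$ for $\lambda>0$, and Lebesgue measure $|\cdot|$. $Y=[0,2)^3$. For $k\in\mathbb{Z}^3$, $2k=(2k_1,2k_2,2k_3)$. For $\varepsilon>0$ the sets $Y^\varepsilon_k=\delta_\varepsilon(2k\cdot Y)$, $k\in\mathbb{Z}^3$, tile $\mathbb{H}^1$ (they are disjoint and cover it). For $x\in\mathbb{H}^1$, $[\delta_{1/\varepsilon}x]_{\mathbb{H}}\in\mathbb{Z}^3$ is the unique $k$ with $x\in Y^\varepsilon_k$, and $\{\delta_{1/\varepsilon}x\}_{\mathbb{H}}=(2[\delta_{1/\varepsilon}x]_{\mathbb{H}})^{-1}\cdot\delta_{1/\varepsilon}x\in Y$. Let $E_\varepsilon=\{k\in\mathbb{Z}^3:Y^\varepsilon_k\subset\Omega\}$,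 $\Omega_\varepsilon=\bigcup_{k\in E_\varepsilon}Y^\varepsilon_k$, $\Lambda_\varepsilon=\Omega\setminus\Omega_\varepsilon$. The unfolding of $\psi:\Omega\to\mathbb{R}$ is $T^\varepsilon(\psi):\Omega\times Y\to\mathbb{R}$, with $T^\varepsilon(\psi)(x,y)=\psi\big(\delta_\varepsilon(2[\delta_{1/\varepsilon}x]_{\mathbb{H}})\cdot\delta_\varepsilon y\big)$ for $(x,y)\in\Omega_\varepsilon\times Y$ and $T^\varepsilon(\psi)(x,y)=0$ for $(x,y)\in\Lambda_\varepsilon\times Y$. The averaging operator is defined for $\phi$ on $\Omega\times Y$ by $\mathcal{U}_\varepsilon(\phi)(x)=\frac1{|Y|}\int_Y\phi\big(\delta_\varepsilon(2[\delta_{1/\varepsilon}x]_{\mathbb{H}})\cdot\delta_\varepsilon z,\{\delta_{1/\varepsilon}x\}_{\mathbb{H}}\big)\,dz$ for a.e. $x\in\Omega_\varepsilon$ and $\mathcal{U}_\varepsilon(\phi)(x)=0$ for a.e. $x\in\Lambda_\varepsilon$. *)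

theory Defs
  imports "HOL-Analysis.Analysis"
begin

definition heis_mult :: "real^3 \<Rightarrow> real^3 \<Rightarrow> real^3"  (infixl "\<cdot>\<^sub>H" 70) where
  "p \<cdot>\<^sub>H q = vector [p$1 + q$1, p$2 + q$2, p$3 + q$3 + 2 * (p$2 * q$1 - p$1 * q$2)]"

definition heis_inv :: "real^3 \<Rightarrow> real^3" where
  "heis_inv x = - x"

definition heis_dil :: "real \<Rightarrow> real^3 \<Rightarrow> real^3" where
  "heis_dil r x = vector [r * x$1, r * x$2, r\<^sup>2 * x$3]"

definition unit_cell :: "(real^3) set" where
  "unit_cell = {y. \<forall>i. 0 \<le> y$i \<and> y$i < 2}"

definition twice :: "int^3 \<Rightarrow> real^3" where
  "twice k = (\<chi> i. 2 * real_of_int (k$i))"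

definition cell :: "real \<Rightarrow> int^3 \<Rightarrow> (real^3) set" where
  "cell \<epsilon> k = (\<lambda>y. heis_dil \<epsilon> (twice k \<cdot>\<^sub>H y)) ` unit_cell"

text \<open>\<open>cell_index \<epsilon> x\<close> is the integer part of the dilate of \<open>x\<close> by \<open>1/\<epsilon>\<close>; it is well defined for
  \<open>\<epsilon> > 0\<close> by \<open>cell_ex1\<close> below.\<close>

definition cell_index :: "real \<Rightarrow> real^3 \<Rightarrow> int^3" where
  "cell_index \<epsilon> x = (THE k. x \<in> cell \<epsilon> k)"

definition cell_frac :: "real \<Rightarrow> real^3 \<Rightarrow> real^3" where
  "cell_frac \<epsilon> x = heis_inv (twice (cell_index \<epsilon> x)) \<cdot>\<^sub>H heis_dil (1/\<epsilon>) x"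

definition inner_cells :: "real \<Rightarrow> (real^3) set \<Rightarrow> (int^3) set" where
  "inner_cells \<epsilon> \<Omega> = {k. cell \<epsilon> k \<subseteq> \<Omega>}"

definition inner_part :: "real \<Rightarrow> (real^3) set \<Rightarrow> (real^3) set" where
  "inner_part \<epsilon> \<Omega> = (\<Union>k\<in>inner_cells \<epsilon> \<Omega>. cell \<epsilon> k)"

text \<open>Functions on \<open>\<Omega>\<close> and on \<open>\<Omega> \<times> unit_cell\<close> are total functions whose values outside these sets
  are irrelevant; on \<open>\<Omega> - inner_part \<epsilon> \<Omega>\<close> both operators give \<open>0\<close>.\<close>

definition unfolding_op ::
    "real \<Rightarrow> (real^3) set \<Rightarrow> (real^3 \<Rightarrow> real) \<Rightarrow> (real^3) \<times> (real^3) \<Rightarrow> real" where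
  "unfolding_op \<epsilon> \<Omega> \<psi> = (\<lambda>(x, y).
     if x \<in> inner_part \<epsilon> \<Omega>
     then \<psi> (heis_dil \<epsilon> (twice (cell_index \<epsilon> x)) \<cdot>\<^sub>H heis_dil \<epsilon> y)
     else 0)"

definition averaging_op ::
    "real \<Rightarrow> (real^3) set \<Rightarrow> ((real^3) \<times> (real^3) \<Rightarrow> real) \<Rightarrow> real^3 \<Rightarrow> real" where
  "averaging_op \<epsilon> \<Omega> \<phi> x =
     (if x \<in> inner_part \<epsilon> \<Omega>
      then 1 / measure lebesgue unit_cell *
        (\<integral>z. \<phi> (heis_dil \<epsilon> (twice (cell_index \<epsilon> x)) \<cdot>\<^sub>H heis_dil \<epsilon> z, cell_frac \<epsilon> x)
           \<partial>(lebesgue_on unit_cell))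
      else 0)"

definition in_Lp :: "real \<Rightarrow> 'a::euclidean_space set \<Rightarrow> ('a \<Rightarrow> real) \<Rightarrow> bool" where
  "in_Lp p S f \<longleftrightarrow> f \<in> borel_measurable (lebesgue_on S) \<and>
     integrable (lebesgue_on S) (\<lambda>x. \<bar>f x\<bar> powr p)"

lemma mem_cell_iff:
  assumes "\<epsilon> > 0"
  shows "x \<in> cell \<epsilon> k \<longleftrightarrow> heis_inv (twice k) \<cdot>\<^sub>H heis_dil (1/\<epsilon>) x \<in> unit_cell"
proof
  assume "x \<in> cell \<epsilon> k"
  then obtain y where y: "y \<in> unit_cell" "x = heis_dil \<epsilon> (twice k \<cdot>\<^sub>H y)"
    by (auto simp: cell_def)
  have "heis_inv (twice k) \<cdot>\<^sub>H heis_dil (1/\<epsilon>) x = y"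
    using assms unfolding y(2) heis_mult_def heis_inv_def heis_dil_def vec_eq_iff forall_3
    by (simp add: field_simps power2_eq_square)
  with y(1) show "heis_inv (twice k) \<cdot>\<^sub>H heis_dil (1/\<epsilon>) x \<in> unit_cell" by simp
next
  assume *: "heis_inv (twice k) \<cdot>\<^sub>H heis_dil (1/\<epsilon>) x \<in> unit_cell"
  have "x = heis_dil \<epsilon> (twice k \<cdot>\<^sub>H (heis_inv (twice k) \<cdot>\<^sub>H heis_dil (1/\<epsilon>) x))"
    using assms unfolding heis_mult_def heis_inv_def heis_dil_def vec_eq_iff forall_3
    by (simp add: field_simps power2_eq_square)
  with * show "x \<in> cell \<epsilon> k" unfolding cell_def by blast
qed

lemma cell_ex1:
  assumes "\<epsilon> > 0"
  shows "\<exists>!k. x \<in> cell \<epsilon> k"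
proof -
  have fl: "0 \<le> a - 2 * real_of_int m \<and> a - 2 * real_of_int m < 2 \<longleftrightarrow> m = \<lfloor>a / 2\<rfloor>" for a m
    by (auto simp: eq_commute[of m] floor_eq_iff) 
  define u where "u = heis_dil (1/\<epsilon>) x"
  define a where "a = \<lfloor>u$1 / 2\<rfloor>"
  define b where "b = \<lfloor>u$2 / 2\<rfloor>"
  define c where "c = \<lfloor>(u$3 - 4 * (b * u$1 - a * u$2)) / 2\<rfloor>"
  have "x \<in> cell \<epsilon> k \<longleftrightarrow> k$1 = a \<and> k$2 = b \<and> k$3 = c" for k
  proof -
    have "x \<in> cell \<epsilon> k \<longleftrightarrow>
        (0 \<le> u$1 - 2 * real_of_int (k$1) \<and> u$1 - 2 * real_of_int (k$1) < 2) \<and>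
        (0 \<le> u$2 - 2 * real_of_int (k$2) \<and> u$2 - 2 * real_of_int (k$2) < 2) \<and>
        (0 \<le> (u$3 - 4 * (k$2 * u$1 - k$1 * u$2)) - 2 * real_of_int (k$3) \<and>
         (u$3 - 4 * (k$2 * u$1 - k$1 * u$2)) - 2 * real_of_int (k$3) < 2)"
      unfolding mem_cell_iff[OF assms] u_def[symmetric]
      by (simp add: unit_cell_def heis_mult_def heis_inv_def twice_def forall_3 algebra_simps)
    then show ?thesis
      unfolding fl by (auto simp: a_def b_def c_def)
  qed
  then have "x \<in> cell \<epsilon> k \<longleftrightarrow> k = vector [a, b, c]" for k
    by (simp add: vec_eq_iff forall_3)
  then show ?thesis by simp
qed

end

theory Submission
  imports Defs
begin

text \<open>
  Since \<open>\<Omega>\<close> is bounded, only finitely many cells lie in \<open>\<Omega>\<close>, so both sides split into finite sums over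
  these cells. The cell with index \<open>k\<close> is the image of \<open>Y\<close> under the affine bijection
  \<open>A\<^sub>k y = \<delta>\<^sub>\<epsilon>(2k \<cdot> y)\<close>, whose linear part is a dilation composed with a shear and has determinant
  \<open>\<epsilon>\<^sup>4\<close>. Substituting \<open>x = A\<^sub>k y\<close> in the outer integral on the left and \<open>x = A\<^sub>k z\<close> in the
  \<open>x\<close>-integral on the right turns both contributions into
  \<open>\<epsilon>\<^sup>4 / |Y|\<close> times the integral of \<open>\<phi>(A\<^sub>k z, y) \<psi>(A\<^sub>k y)\<close> over \<open>Y \<times> Y\<close>, up to the order of
  integration. Fubini applies because Young's inequality dominates the integrand by
  \<open>|\<phi>|\<^sup>q/q + |\<psi> \<circ> A\<^sub>k|\<^sup>p/p\<close>.
\<close>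

section \<open>Integration over subsets and Fubini's theorem for the completed Lebesgue
  measure\<close>

lemma integrable_lebesgue_on_iff_mult_indicator:
  fixes f :: "'a::euclidean_space \<Rightarrow> real"
  assumes "S \<in> sets lebesgue"
  shows "integrable (lebesgue_on S) f \<longleftrightarrow> integrable lebesgue (\<lambda>x. indicator S x * f x)"
  using assms by (subst integrable_restrict_space) auto

lemma integral_lebesgue_on_eq_mult_indicator:
  fixes f :: "'a::euclidean_space \<Rightarrow> real"
  assumes "S \<in> sets lebesgue"
  shows "integral\<^sup>L (lebesgue_on S) f = (\<integral>x. indicator S x * f x \<partial>lebesgue)"
  using assms by (subst integral_restrict_space) auto

lemma vimage_snd_null_sets_lborel:
  fixes N :: "'b::euclidean_space set"
  assumes N: "N \<in> null_sets lborel"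
  shows "(snd :: 'a::euclidean_space \<times> 'b \<Rightarrow> 'b) -` N \<in> null_sets lborel"
proof -
  have "emeasure (lborel \<Otimes>\<^sub>M lborel) ((UNIV :: 'a set) \<times> N) = 0"
    using N by (subst lborel.emeasure_pair_measure_Times) (auto simp: null_sets_def)
  then have "emeasure lborel ((UNIV :: 'a set) \<times> N) = 0"
    by (simp add: lborel_prod)
  moreover have "(UNIV :: 'a set) \<times> N \<in> sets lborel"
    using N by (auto simp: null_sets_def intro!: borel_Times)
  moreover have "(snd :: 'a \<times> 'b \<Rightarrow> 'b) -` N = UNIV \<times> N" by auto
  ultimately show ?thesis by (simp add: null_sets_def)
qed

text \<open>The domain carries the completion of the Borel product, not a product of completions.
  Borel measurability of \<open>snd\<close> passes to the completions because a null set
  \<open>N\<close> has the null preimage \<open>UNIV \<times> N\<close>.\<close>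

lemma measurable_snd_lebesgue:
  "snd \<in> (lebesgue :: ('a::euclidean_space \<times> 'b::euclidean_space) measure) \<rightarrow>\<^sub>M lebesgue"
proof (rule completion.measurable_completion2)
  have "snd \<in> (borel :: ('a \<times> 'b) measure) \<rightarrow>\<^sub>M borel"
    by (intro borel_measurable_continuous_onI continuous_intros)
  then show m: "snd \<in> (lebesgue :: ('a \<times> 'b) measure) \<rightarrow>\<^sub>M lborel"
    by (intro measurable_completion) simp
  show "null_sets lborel \<subseteq> null_sets (distr (lebesgue :: ('a \<times> 'b) measure) lborel snd)"
  proof
    fix N :: "'b set" assume N: "N \<in> null_sets lborel"
    with vimage_snd_null_sets_lborel[OF N, where 'a = 'a] m
    show "N \<in> null_sets (distr (lebesgue :: ('a \<times> 'b) measure) lborel snd)"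
      by (auto simp: null_sets_def emeasure_distr)
  qed
qed

text \<open>A Borel representative \<open>h\<close> of \<open>f\<close> allows Fubini on the
  uncompleted product, and the exceptional set pulled back along \<open>snd\<close> stays null. This
  serves the part of the Young bound that depends on the second variable alone and is cut off to a
  cell in the first.\<close>

lemma integrable_indicator_fst_times_snd:
  fixes f :: "'b::euclidean_space \<Rightarrow> real" and S :: "'a::euclidean_space set"
  assumes S[measurable]: "S \<in> sets borel" and fin: "emeasure lborel S < \<infinity>" and f: "integrable lebesgue f"
  shows "integrable lebesgue (\<lambda>w. indicator S (fst w) * f (snd w))"
proof -
  obtain h where h: "h \<in> borel_measurable lborel" and fh: "AE y in lborel. f y = h y"
    using completion_ex_borel_measurable_real[of f lborel] f by auto
  have [measurable]: "h \<in> borel_measurable borel" using h by simp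
  have "integrable lebesgue h"
    by (rule integrable_cong_AE_imp[OF f measurable_completion[OF h]])
       (use AE_completion[OF fh] in \<open>auto simp: eq_commute\<close>)
  then have hi: "integrable lborel h"
    using h by (simp add: integrable_completion)
  have "integrable (lborel \<Otimes>\<^sub>M lborel) (\<lambda>w. indicator S (fst w) * h (snd w))"
  proof (rule lborel_pair.Fubini_integrable)
    show "integrable lborel (\<lambda>x. \<integral>y. norm (indicator S (fst (x, y)) * h (snd (x, y))) \<partial>lborel)"
      using fin by (simp add: abs_mult)
    show "AE x in lborel. integrable lborel (\<lambda>y. indicator S (fst (x, y)) * h (snd (x, y)))"
      using hi by simp
  qed measurable
  then have *: "integrable lborel (\<lambda>w. indicator S (fst w) * h (snd w))"
    by (simp add: lborel_prod)
  then have **: "integrable lebesgue (\<lambda>w. indicator S (fst w) * h (snd w))"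
    by (subst integrable_completion) auto
  obtain N where N: "N \<in> null_sets lborel" and fN: "{y. f y \<noteq> h y} \<subseteq> N"
    using fh by (auto simp: eventually_ae_filter)
  have "AE w in lborel. (w :: 'a \<times> 'b) \<notin> snd -` N"
    by (rule AE_not_in) (rule vimage_snd_null_sets_lborel[OF N])
  then have "AE w in lborel. indicator S (fst (w :: 'a \<times> 'b)) * h (snd w) = indicator S (fst w) * f (snd w)"
    by eventually_elim (use fN in force)
  then have ae: "AE w in lebesgue. indicator S (fst (w :: 'a \<times> 'b)) * h (snd w) = indicator S (fst w) * f (snd w)"
    by (rule AE_completion)
  show ?thesis
    by (rule integrable_cong_AE_imp[OF ** borel_measurable_AE[OF borel_measurable_integrable[OF **] ae] ae])
qed

text \<open>Exchanging the two almost-everywhere quantifiers calls for a measurable predicate, so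
  \<open>Q\<close> is first replaced by avoidance of a measurable null set \<open>N\<close>.\<close>

lemma (in pair_sigma_finite) AE_pair_snd:
  assumes "AE w in M1 \<Otimes>\<^sub>M M2. Q w"
  shows "AE y in M2. AE x in M1. Q (x, y)"
proof -
  obtain N where N[measurable]: "N \<in> sets (M1 \<Otimes>\<^sub>M M2)" and N0: "N \<in> null_sets (M1 \<Otimes>\<^sub>M M2)"
    and Q: "{w \<in> space (M1 \<Otimes>\<^sub>M M2). \<not> Q w} \<subseteq> N"
    using assms unfolding eventually_ae_filter by blast
  have "AE x in M1. AE y in M2. (x, y) \<notin> N"
    by (rule AE_pair) (rule AE_not_in[OF N0])
  then have "AE y in M2. AE x in M1. (x, y) \<notin> N"
    by (subst (asm) AE_commute) auto
  then show ?thesis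
    using AE_space
  proof eventually_elim
    fix y assume *: "AE x in M1. (x, y) \<notin> N" and y: "y \<in> space M2"
    from * AE_space show "AE x in M1. Q (x, y)"
      by eventually_elim (use Q y in \<open>auto simp: space_pair_measure\<close>)
  qed
qed

text \<open>This is Fubini with the first variable innermost, for functions measurable only with
  respect to the completion. Passing to a Borel representative \<open>h\<close> changes almost every
  section only on a null set.\<close>

lemma
  fixes f :: "'a::euclidean_space \<times> 'b::euclidean_space \<Rightarrow> real"
  assumes f: "integrable lebesgue f"
  shows integrable_snd_lebesgue: "integrable lebesgue (\<lambda>y. \<integral>x. f (x, y) \<partial>lebesgue)"
    and integral_snd_lebesgue: "(\<integral>y. (\<integral>x. f (x, y) \<partial>lebesgue) \<partial>lebesgue) = integral\<^sup>L lebesgue f"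
proof -
  obtain h where h[measurable]: "h \<in> borel_measurable lborel" and fh: "AE w in lborel. f w = h w"
    using completion_ex_borel_measurable_real[of f lborel] f by auto
  have fh': "AE w in lebesgue. f w = h w"
    using fh by (rule AE_completion)
  have hm: "h \<in> borel_measurable lebesgue"
    using h by (rule measurable_completion)
  have "integrable lebesgue h"
    by (rule integrable_cong_AE_imp[OF f hm]) (use fh' in \<open>auto simp: eq_commute\<close>)
  then have hi: "integrable (lborel \<Otimes>\<^sub>M lborel) (case_prod (\<lambda>x y. h (x, y)))"
    by (simp add: integrable_completion lborel_prod)
  let ?F = "\<lambda>y. \<integral>x. f (x, y) \<partial>lebesgue" and ?H = "\<lambda>y. \<integral>x. h (x, y) \<partial>lborel"
  have "AE y in lborel. ?F y = ?H y"
  proof -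
    have "AE w in lborel \<Otimes>\<^sub>M lborel. f w = h w"
      using fh by (subst lborel_prod)
    then have "AE y in lborel. AE x in lborel. f (x, y) = h (x, y)"
      by (rule lborel_pair.AE_pair_snd)
    moreover have "AE y in lborel. integrable lborel (\<lambda>x. h (x, y))"
      by (rule lborel_pair.AE_integrable_snd[OF hi])
    ultimately show ?thesis
    proof eventually_elim
      fix y assume *: "AE x in lborel. f (x, y) = h (x, y)" "integrable lborel (\<lambda>x. h (x, y))"
      have hy: "(\<lambda>x. h (x, y)) \<in> borel_measurable lborel"
        using *(2) by auto
      have ae: "AE x in lebesgue. f (x, y) = h (x, y)"
        using *(1) by (rule AE_completion)
      \<comment> \<open>Agreement almost everywhere with a Borel section gives measurability; it is
        available only for almost every \<open>y\<close>.\<close>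
      have "(\<lambda>x. f (x, y)) \<in> borel_measurable lebesgue"
        by (rule borel_measurable_AE[OF measurable_completion[OF hy]]) (use ae in \<open>auto simp: eq_commute\<close>)
      then have "?F y = (\<integral>x. h (x, y) \<partial>lebesgue)"
        by (rule integral_cong_AE[OF _ measurable_completion[OF hy] ae])
      then show "?F y = ?H y"
        using hy by (simp add: integral_completion)
    qed
  qed
  then have eq: "AE y in lebesgue. ?F y = ?H y"
    by (rule AE_completion)
  have Hi: "integrable lborel ?H"
    by (rule lborel_pair.integrable_snd[OF hi])
  then have Hm: "?H \<in> borel_measurable lborel" by auto
  have Hi': "integrable lebesgue ?H"
    using Hi Hm by (simp add: integrable_completion)
  have Fm: "?F \<in> borel_measurable lebesgue"
    by (rule borel_measurable_AE[OF measurable_completion[OF Hm]]) (use eq in \<open>auto simp: eq_commute\<close>)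
  show "integrable lebesgue ?F"
    by (rule integrable_cong_AE_imp[OF Hi' Fm]) (use eq in \<open>auto simp: eq_commute\<close>)
  have "integral\<^sup>L lebesgue ?F = integral\<^sup>L lebesgue ?H"
    by (intro integral_cong_AE Fm eq measurable_completion Hm)
  also have "\<dots> = integral\<^sup>L lborel ?H"
    using Hm by (rule integral_completion)
  also have "\<dots> = integral\<^sup>L (lborel \<Otimes>\<^sub>M lborel) (case_prod (\<lambda>x y. h (x, y)))"
    by (rule lborel_pair.integral_snd[OF hi])
  also have "\<dots> = integral\<^sup>L lborel h"
    by (simp add: lborel_prod)
  also have "\<dots> = integral\<^sup>L lebesgue h"
    using h by (rule integral_completion[symmetric])
  also have "\<dots> = integral\<^sup>L lebesgue f"
    by (intro integral_cong_AE hm) (use f fh' in \<open>auto simp: eq_commute\<close>)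
  finally show "integral\<^sup>L lebesgue ?F = integral\<^sup>L lebesgue f" .
qed

section \<open>The affine maps that parametrise the cells\<close>

definition cell_map :: "real \<Rightarrow> int^3 \<Rightarrow> real^3 \<Rightarrow> real^3" where
  "cell_map \<epsilon> k y = heis_dil \<epsilon> (twice k \<cdot>\<^sub>H y)"

text \<open>For \<epsilon> > 0 this agrees with \<open>cell_frac \<epsilon>\<close> on
  \<open>cell \<epsilon> k\<close>, but with \<open>k\<close> fixed it is affine on the whole space
  and inverts \<open>cell_map \<epsilon> k\<close>.\<close>

definition cell_inv :: "real \<Rightarrow> int^3 \<Rightarrow> real^3 \<Rightarrow> real^3" where
  "cell_inv \<epsilon> k x = heis_inv (twice k) \<cdot>\<^sub>H heis_dil (1/\<epsilon>) x"

text \<open>The linear part of \<open>cell_map\<close>; the factor 4 is the 2 of the group law times the 2 of \<open>twice\<close>.\<close>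

definition cell_lin :: "real \<Rightarrow> int^3 \<Rightarrow> real^3 \<Rightarrow> real^3" where
  "cell_lin \<epsilon> k y = vector [\<epsilon> * y$1, \<epsilon> * y$2, \<epsilon>\<^sup>2 * (y$3 + 4 * (k$2 * y$1 - k$1 * y$2))]"

lemma cell_map_eq: "cell_map \<epsilon> k y = cell_lin \<epsilon> k y + heis_dil \<epsilon> (twice k)"
  unfolding cell_map_def cell_lin_def heis_mult_def heis_dil_def twice_def vec_eq_iff forall_3
  by (simp add: algebra_simps)

lemma linear_cell_lin: "linear (cell_lin \<epsilon> k)"
  by (rule linearI) (simp_all add: cell_lin_def vec_eq_iff forall_3 algebra_simps)

text \<open>The matrix is lower triangular with diagonal \<epsilon>, \<epsilon>,
  \<open>\<epsilon>\<^sup>2\<close>; the shear contributes only below the diagonal.\<close>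

lemma det_cell_lin: "det (matrix (cell_lin \<epsilon> k)) = \<epsilon>^4"
  unfolding det_3 matrix_def cell_lin_def
  by (simp add: axis_def) (simp add: power_numeral_reduce)

lemma has_derivative_cell_map: "(cell_map \<epsilon> k has_derivative cell_lin \<epsilon> k) (at x within S)"
proof -
  have "cell_map \<epsilon> k = (\<lambda>y. cell_lin \<epsilon> k y + heis_dil \<epsilon> (twice k))"
    by (rule ext) (rule cell_map_eq)
  then show ?thesis
    by (auto intro!: derivative_eq_intros linear_imp_has_derivative linear_cell_lin)
qed

section \<open>Change of variables for a bijection with constant derivative\<close>

text \<open>The change of variables theorem for vector-valued functions is applied to the
  \<open>real^1\<close>-valued function \<open>vec (f x)\<close> and translated back. The constant
  Jacobian factor is nonzero and so does not affect integrability.\<close>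

lemma
  fixes f :: "real^'m::{finite,wellorder} \<Rightarrow> real" and g :: "real^'m::_ \<Rightarrow> real^'m::_"
  assumes "bij g" and "\<And>x. (g has_derivative g') (at x)" and det: "det (matrix g') \<noteq> 0"
  shows integrable_lebesgue_comp_iff: "integrable lebesgue (\<lambda>x. f (g x)) \<longleftrightarrow> integrable lebesgue f"
    and integral_lebesgue_comp:
      "\<bar>det (matrix g')\<bar> * (\<integral>x. f (g x) \<partial>lebesgue) = (\<integral>x. f x \<partial>lebesgue)"
proof -
  let ?d = "\<bar>det (matrix g')\<bar>"
  have "range g = UNIV"
    using \<open>bij g\<close> by (rule bij_is_surj)
  with has_absolute_integral_change_of_variables
      [of UNIV g "\<lambda>_. g'" "\<lambda>x. vec (f x) :: real^1", OF _ has_derivative_at_withinI[OF assms(2)] bij_is_inj[OF assms(1)]]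
  have *: "(\<lambda>x. ?d *\<^sub>R vec (f (g x)) :: real^1) absolutely_integrable_on UNIV \<and>
      integral UNIV (\<lambda>x. ?d *\<^sub>R vec (f (g x)) :: real^1) = vec b
    \<longleftrightarrow> (\<lambda>x. vec (f x) :: real^1) absolutely_integrable_on UNIV \<and>
      integral UNIV (\<lambda>x. vec (f x) :: real^1) = vec b" for b
    by simp
  \<comment> \<open>Since \<open>b\<close> is arbitrary, setting it to either integral yields both
    the equivalence of integrability and the equality of the integrals.\<close>
  have **: "integrable lebesgue (\<lambda>x. ?d * f (g x)) \<and> integral UNIV (\<lambda>x. ?d * f (g x)) = b
    \<longleftrightarrow> integrable lebesgue f \<and> integral UNIV f = b" for b
    using *[of b] unfolding absolutely_integrable_on_1_iff integral_on_1_eq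
    by (simp add: set_integrable_def vec_eq_iff)
  show iff: "integrable lebesgue (\<lambda>x. f (g x)) \<longleftrightarrow> integrable lebesgue f"
    using ** det by auto
  show "?d * (\<integral>x. f (g x) \<partial>lebesgue) = (\<integral>x. f x \<partial>lebesgue)"
  proof (cases "integrable lebesgue f")
    case True
    then have "integral UNIV (\<lambda>x. ?d * f (g x)) = integral UNIV f" "integrable lebesgue (\<lambda>x. ?d * f (g x))"
      using ** by auto
    with True iff show ?thesis
      by (simp add: integral_lebesgue)
  next
    \<comment> \<open>Both integrals have the default value 0 here.\<close>
    case False
    with iff show ?thesis
      by (simp add: not_integrable_integral_eq)
  qed
qed

section \<open>Inverse maps, measurability and finite number of the cells\<close>

lemma cell_inv_cell_map: "\<epsilon> > 0 \<Longrightarrow> cell_inv \<epsilon> k (cell_map \<epsilon> k y) = y"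
  unfolding cell_map_def cell_inv_def heis_mult_def heis_inv_def heis_dil_def vec_eq_iff forall_3
  by (simp add: field_simps power2_eq_square)

lemma cell_map_cell_inv: "\<epsilon> > 0 \<Longrightarrow> cell_map \<epsilon> k (cell_inv \<epsilon> k y) = y"
  unfolding cell_map_def cell_inv_def heis_mult_def heis_inv_def heis_dil_def vec_eq_iff forall_3
  by (simp add: field_simps power2_eq_square)

lemma bij_cell_map: "\<epsilon> > 0 \<Longrightarrow> bij (cell_map \<epsilon> k)"
  by (rule o_bij[of "cell_inv \<epsilon> k"]) (auto simp: cell_inv_cell_map cell_map_cell_inv)

lemma cell_map_mem_cell_iff: "\<epsilon> > 0 \<Longrightarrow> cell_map \<epsilon> k y \<in> cell \<epsilon> k \<longleftrightarrow> y \<in> unit_cell"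
  using cell_inv_cell_map by (simp add: mem_cell_iff cell_inv_def)

text \<open>Dilations are automorphisms of the Heisenberg group. This identifies the argument used
  in both operators with \<open>cell_map\<close>.\<close>

lemma cell_map_eq_mult: "heis_dil \<epsilon> (twice k) \<cdot>\<^sub>H heis_dil \<epsilon> y = cell_map \<epsilon> k y"
  unfolding cell_map_def heis_mult_def heis_dil_def vec_eq_iff forall_3
  by (simp add: algebra_simps power2_eq_square)

lemma cell_index_eq: "\<epsilon> > 0 \<Longrightarrow> x \<in> cell \<epsilon> k \<Longrightarrow> cell_index \<epsilon> x = k"
  unfolding cell_index_def using cell_ex1 by (blast intro: the1_equality)

lemma unit_cell_borel: "unit_cell \<in> sets borel"
proof -
  have "unit_cell = (\<Inter>i\<in>UNIV. {y::real^3. 0 \<le> y$i} \<inter> {y. y$i < 2})"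
    by (auto simp: unit_cell_def)
  also have "\<dots> \<in> sets borel"
    by (intro sets.finite_INT sets.Int) (auto intro!: borel_closed closed_Collect_le borel_open open_Collect_less continuous_intros)
  finally show ?thesis .
qed

lemma unit_cell_lebesgue: "unit_cell \<in> sets lebesgue"
  using unit_cell_borel by simp

lemma continuous_on_cell_inv:
  assumes "\<epsilon> > 0"
  shows "continuous_on S (cell_inv \<epsilon> k)"
proof -
  have "\<forall>i. continuous_on S (\<lambda>x. cell_inv \<epsilon> k x $ i)"
    unfolding cell_inv_def heis_mult_def heis_dil_def heis_inv_def forall_3
    using assms by (auto intro!: continuous_intros)
  then have "continuous_on S (\<lambda>x. \<chi> i. cell_inv \<epsilon> k x $ i)"
    by (intro continuous_on_vec_lambda) auto
  then show ?thesis by simp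
qed

text \<open>The cell is the preimage of \<open>unit_cell\<close> under the continuous map
  \<open>cell_inv \<epsilon> k\<close>.\<close>

lemma cell_borel:
  assumes "\<epsilon> > 0"
  shows "cell \<epsilon> k \<in> sets borel"
proof -
  have "cell_inv \<epsilon> k \<in> borel_measurable borel"
    by (intro borel_measurable_continuous_onI continuous_on_cell_inv assms)
  moreover have "cell \<epsilon> k = cell_inv \<epsilon> k -` unit_cell \<inter> space borel"
    using assms by (auto simp: mem_cell_iff cell_inv_def)
  ultimately show ?thesis
    using unit_cell_borel by (metis measurable_sets)
qed

text \<open>An inner cell contains its corner \<open>cell_map \<epsilon> k 0\<close>, whose
  coordinates are 2\<epsilon> times the first two entries of \<open>k\<close> and
  \<open>2 * \<epsilon>\<^sup>2\<close> times the third. A bound on \<Omega> therefore bounds the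
  integer entries.\<close>

lemma finite_inner_cells:
  assumes "\<epsilon> > 0" "bounded \<Omega>"
  shows "finite (inner_cells \<epsilon> \<Omega>)"
proof -
  obtain B where B: "\<And>x. x \<in> \<Omega> \<Longrightarrow> norm x \<le> B"
    using assms(2) by (auto simp: bounded_iff)
  \<comment> \<open>The first two coordinates scale by \<epsilon> and the third by
    \<open>\<epsilon>\<^sup>2\<close>; these are the two values given to \<open>s\<close> in
    \<open>bd\<close>.\<close>
  define M where "M = max \<lceil>B / \<epsilon>\<rceil> \<lceil>B / \<epsilon>\<^sup>2\<rceil>"
  have "inner_cells \<epsilon> \<Omega> \<subseteq> (\<lambda>(a, b, c). vector [a, b, c]) ` ({-M..M} \<times> {-M..M} \<times> {-M..M})"
  proof
    fix k assume "k \<in> inner_cells \<epsilon> \<Omega>"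
    moreover have "cell_map \<epsilon> k 0 \<in> cell \<epsilon> k"
      using assms by (simp add: cell_map_mem_cell_iff unit_cell_def)
    ultimately have n: "norm (cell_map \<epsilon> k 0) \<le> B"
      using B by (auto simp: inner_cells_def)
    have c: "cell_map \<epsilon> k 0 = heis_dil \<epsilon> (twice k)"
      by (simp add: cell_map_eq linear_0[OF linear_cell_lin])
    have bd: "k$i \<in> {-M..M}" if "s * \<bar>2 * real_of_int (k$i)\<bar> \<le> B" "s > 0" "\<lceil>B / s\<rceil> \<le> M" for s i
    proof -
      have "\<bar>2 * real_of_int (k$i)\<bar> \<le> B / s"
        using that by (simp add: field_simps)
      then have "real_of_int \<bar>k$i\<bar> \<le> B / s" by simp
      then have "\<bar>k$i\<bar> \<le> \<lceil>B / s\<rceil>" by linarith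
      with that(3) show ?thesis by auto
    qed
    have "k$1 \<in> {-M..M}" 
      by (rule bd[of \<epsilon>]) (use component_le_norm_cart[of "cell_map \<epsilon> k 0" 1] n assms in \<open>auto simp: c heis_dil_def twice_def M_def abs_mult\<close>)
    moreover have "k$2 \<in> {-M..M}"
      by (rule bd[of \<epsilon>]) (use component_le_norm_cart[of "cell_map \<epsilon> k 0" 2] n assms in \<open>auto simp: c heis_dil_def twice_def M_def abs_mult\<close>)
    moreover have "k$3 \<in> {-M..M}"
      by (rule bd[of "\<epsilon>\<^sup>2"]) (use component_le_norm_cart[of "cell_map \<epsilon> k 0" 3] n assms in \<open>auto simp: c heis_dil_def twice_def M_def abs_mult\<close>)
    moreover have "k = vector [k$1, k$2, k$3]"
      by (simp add: vec_eq_iff forall_3)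
    ultimately show "k \<in> (\<lambda>(a, b, c). vector [a, b, c]) ` ({-M..M} \<times> {-M..M} \<times> {-M..M})"
      by (intro image_eqI[of _ _ "(k$1, k$2, k$3)"]) auto
  qed
  then show ?thesis
    by (rule finite_subset) auto
qed


section \<open>Substitution along the cell maps and the integrand on one cell\<close>

lemma integrable_lebesgue_cell_map_iff:
  assumes "\<epsilon> > 0"
  shows "integrable lebesgue (\<lambda>y. f (cell_map \<epsilon> k y) :: real) \<longleftrightarrow> integrable lebesgue f"
  using assms by (intro integrable_lebesgue_comp_iff[OF bij_cell_map has_derivative_cell_map]) (auto simp: det_cell_lin)

lemma integral_lebesgue_cell_map:
  fixes f :: "real^3 \<Rightarrow> real"
  assumes "\<epsilon> > 0"
  shows "\<epsilon>^4 * (\<integral>y. f (cell_map \<epsilon> k y) \<partial>lebesgue) = (\<integral>x. f x \<partial>lebesgue)"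
  using integral_lebesgue_comp[OF bij_cell_map has_derivative_cell_map, of \<epsilon> k f] assms by (simp add: det_cell_lin)

text \<open>This is the share of one cell in the product of \<phi> with the unfolding of \<psi>:
  over the cell the unfolded function depends on the second variable only. The indicator extends it
  by zero, so that Fubini can be used on the whole space.\<close>

definition cell_integrand ::
    "real \<Rightarrow> int^3 \<Rightarrow> (real^3 \<Rightarrow> real) \<Rightarrow> ((real^3) \<times> (real^3) \<Rightarrow> real) \<Rightarrow> (real^3) \<times> (real^3) \<Rightarrow> real" where
  "cell_integrand \<epsilon> k \<psi> \<phi> w =
     indicator (cell \<epsilon> k \<times> unit_cell) w * (\<phi> w * \<psi> (cell_map \<epsilon> k (snd w)))"

text \<open>Young's inequality leaves a \<phi> term integrable over
  \<open>\<Omega> \<times> unit_cell\<close> and a \<psi> term in the second variable alone,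
  integrable because the cell has finite measure. Measurability of the \<psi> factor is lifted to
  the product through \<open>snd\<close>.\<close>

lemma integrable_cell_integrand:
  assumes \<epsilon>: "\<epsilon> > 0" and \<Omega>: "open \<Omega>" "bounded \<Omega>" and k: "cell \<epsilon> k \<subseteq> \<Omega>"
    and pq: "p > 1" "q > 1" "1 / p + 1 / q = 1"
    and \<psi>: "in_Lp p \<Omega> \<psi>" and \<phi>: "in_Lp q (\<Omega> \<times> unit_cell) \<phi>"
  shows "integrable lebesgue (cell_integrand \<epsilon> k \<psi> \<phi>)"
proof -
  let ?C = "cell \<epsilon> k" and ?Y = "unit_cell"
  have \<Omega>m: "\<Omega> \<in> lmeasurable"
    using \<Omega> by (simp add: lmeasurable_open)
  then have \<Omega>s: "\<Omega> \<in> sets lebesgue" by auto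
  have Cb: "?C \<in> sets borel" using \<epsilon> by (rule cell_borel)
  then have Cs: "?C \<in> sets lebesgue" by simp
  have C_fin: "emeasure lborel ?C < \<infinity>"
    using emeasure_bounded_finite bounded_subset[OF \<Omega>(2) k] by blast
  have "\<Omega> \<times> ?Y \<in> sets borel"
    using \<Omega> unit_cell_borel by (intro borel_Times) auto
  then have \<Omega>Y: "\<Omega> \<times> ?Y \<in> sets lebesgue" by simp
  have ind_C: "indicator ?C (cell_map \<epsilon> k y) = (indicator ?Y y :: real)" for y
    using \<epsilon> by (simp add: indicator_def cell_map_mem_cell_iff)
  interpret \<Omega>: finite_measure "lebesgue_on \<Omega>"
    using \<Omega>m by (rule finite_measure_lebesgue_on)
  \<comment> \<open>As \<Omega> has finite measure, Young's inequality with second factor 1 gives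
    the inclusion of \<open>L^p\<close> in \<open>L^1\<close>.\<close>
  have \<psi>1: "integrable (lebesgue_on \<Omega>) \<psi>"
  proof (rule Bochner_Integration.integrable_bound)
    show "integrable (lebesgue_on \<Omega>) (\<lambda>x. \<bar>\<psi> x\<bar> powr p / p + 1 / q)"
      using \<psi> by (simp add: in_Lp_def)
    show "\<psi> \<in> borel_measurable (lebesgue_on \<Omega>)"
      using \<psi> by (simp add: in_Lp_def)
    show "AE x in lebesgue_on \<Omega>. norm (\<psi> x) \<le> norm (\<bar>\<psi> x\<bar> powr p / p + 1 / q)"
    proof (rule AE_I2)
      fix x
      have "\<bar>\<psi> x\<bar> * 1 \<le> \<bar>\<psi> x\<bar> powr p / p + 1 powr q / q"
        by (rule Youngs_inequality) (use pq in auto)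
      then show "norm (\<psi> x) \<le> norm (\<bar>\<psi> x\<bar> powr p / p + 1 / q)" by simp
    qed
  qed
  \<comment> \<open>Restrict to the cell, then substitute. Applied to \<psi> this yields
    measurability of \<open>h\<close> below, and applied to the power of \<psi> it yields
    \<open>hp\<close>.\<close>
  have on_Y: "integrable lebesgue (\<lambda>y. indicator ?Y y * g (cell_map \<epsilon> k y))"
    if "integrable (lebesgue_on \<Omega>) g" for g :: "real^3 \<Rightarrow> real"
  proof -
    have "integrable lebesgue (\<lambda>x. indicator ?C x *\<^sub>R (indicator \<Omega> x * g x))"
      using that Cs \<Omega>s by (intro integrable_mult_indicator) (auto simp: integrable_lebesgue_on_iff_mult_indicator)
    also have "(\<lambda>x. indicator ?C x *\<^sub>R (indicator \<Omega> x * g x)) = (\<lambda>x. indicator ?C x * g x)"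
    proof
      show "indicator ?C x *\<^sub>R (indicator \<Omega> x * g x) = indicator ?C x * g x" for x
        using k by (cases "x \<in> ?C") (simp_all add: subsetD)
    qed
    finally show ?thesis
      using integrable_lebesgue_cell_map_iff[OF \<epsilon>, of "\<lambda>x. indicator ?C x * g x" k] by (simp add: ind_C)
  qed
  define h where "h y = indicator ?Y y * \<psi> (cell_map \<epsilon> k y)" for y
  have "h \<in> borel_measurable lebesgue"
    using on_Y[OF \<psi>1] by (auto simp: h_def[abs_def])
  then have h_snd: "(\<lambda>w. h (snd w)) \<in> borel_measurable (lebesgue :: ((real^3) \<times> (real^3)) measure)"
    by (rule measurable_compose[OF measurable_snd_lebesgue])
  have hp: "integrable lebesgue (\<lambda>y. \<bar>h y\<bar> powr p)"
  proof -
    \<comment> \<open>The indicator may leave the power because \<open>0 powr p = 0\<close>.\<close>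
    have "(\<lambda>y. \<bar>h y\<bar> powr p) = (\<lambda>y. indicator ?Y y * (\<bar>\<psi> (cell_map \<epsilon> k y)\<bar> powr p))"
      using pq by (auto simp: h_def indicator_def)
    then show ?thesis
      using on_Y[of "\<lambda>x. \<bar>\<psi> x\<bar> powr p"] \<psi> by (simp add: in_Lp_def)
  qed
  have \<phi>m: "(\<lambda>w. indicator (\<Omega> \<times> ?Y) w * \<phi> w) \<in> borel_measurable lebesgue"
    using \<phi> \<Omega>Y by (simp add: in_Lp_def borel_measurable_restrict_space_iff)
  have \<phi>q: "integrable lebesgue (\<lambda>w. indicator (\<Omega> \<times> ?Y) w * \<bar>\<phi> w\<bar> powr q)"
    using \<phi> \<Omega>Y by (simp add: in_Lp_def integrable_lebesgue_on_iff_mult_indicator)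
  have "?C \<times> (UNIV :: (real^3) set) \<in> sets borel"
    using Cb by (intro borel_Times) auto
  then have C_fst: "(\<lambda>w. indicator (?C \<times> (UNIV :: (real^3) set)) w :: real) \<in> borel_measurable lebesgue"
    by (intro borel_measurable_indicator) simp
  \<comment> \<open>Measurability of \<phi> is given only on
    \<open>\<Omega> \<times> unit_cell\<close>, so the integrand is written as a product of factors
    extended by zero, each measurable on the whole space.\<close>
  have eq: "cell_integrand \<epsilon> k \<psi> \<phi> =
      (\<lambda>w. indicator (?C \<times> UNIV) w * ((indicator (\<Omega> \<times> ?Y) w * \<phi> w) * h (snd w)))"
  proof
    show "cell_integrand \<epsilon> k \<psi> \<phi> w =
        indicator (?C \<times> UNIV) w * ((indicator (\<Omega> \<times> ?Y) w * \<phi> w) * h (snd w))" for w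
      using k by (cases "w \<in> ?C \<times> ?Y") (auto simp: cell_integrand_def h_def split: split_indicator)
  qed
  show ?thesis
  proof (rule Bochner_Integration.integrable_bound)
    show "integrable lebesgue (\<lambda>w. indicator (\<Omega> \<times> ?Y) w * \<bar>\<phi> w\<bar> powr q / q +
        indicator ?C (fst w) * \<bar>h (snd w)\<bar> powr p / p)"
      using integrable_indicator_fst_times_snd[OF Cb C_fin hp] \<phi>q by auto
    show "cell_integrand \<epsilon> k \<psi> \<phi> \<in> borel_measurable lebesgue"
      unfolding eq by (intro borel_measurable_times C_fst \<phi>m h_snd)
    show "AE w in lebesgue. norm (cell_integrand \<epsilon> k \<psi> \<phi> w) \<le>
        norm (indicator (\<Omega> \<times> ?Y) w * \<bar>\<phi> w\<bar> powr q / q + indicator ?C (fst w) * \<bar>h (snd w)\<bar> powr p / p)"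
    proof (rule AE_I2)
      fix w
      show "norm (cell_integrand \<epsilon> k \<psi> \<phi> w) \<le>
        norm (indicator (\<Omega> \<times> ?Y) w * \<bar>\<phi> w\<bar> powr q / q + indicator ?C (fst w) * \<bar>h (snd w)\<bar> powr p / p)"
      proof (cases "w \<in> ?C \<times> ?Y")
        case True
        have "\<bar>\<phi> w\<bar> * \<bar>h (snd w)\<bar> \<le> \<bar>\<phi> w\<bar> powr q / q + \<bar>h (snd w)\<bar> powr p / p"
          by (rule Youngs_inequality) (use pq in auto)
        with True k show ?thesis
          by (auto simp: eq abs_mult)
      qed (simp add: cell_integrand_def)
    qed
  qed
qed

section \<open>Decomposition of both operators over the inner cells\<close>

lemma inner_part_memE:
  assumes "\<epsilon> > 0" "x \<in> inner_part \<epsilon> \<Omega>"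
  obtains k where "k \<in> inner_cells \<epsilon> \<Omega>" "x \<in> cell \<epsilon> k" "cell_index \<epsilon> x = k"
    "\<forall>j. x \<in> cell \<epsilon> j \<longleftrightarrow> j = k"
  using assms cell_index_eq unfolding inner_part_def by blast

text \<open>The cells are disjoint, so at most the summand of the cell containing
  \<open>fst w\<close> survives; outside the inner part both sides vanish.\<close>

lemma unfolding_op_eq_sum_cells:
  assumes \<epsilon>: "\<epsilon> > 0" and fin: "finite (inner_cells \<epsilon> \<Omega>)"
  shows "indicator (\<Omega> \<times> unit_cell) w * (\<phi> w * unfolding_op \<epsilon> \<Omega> \<psi> w) =
    (\<Sum>k\<in>inner_cells \<epsilon> \<Omega>. cell_integrand \<epsilon> k \<psi> \<phi> w)"
proof (cases "fst w \<in> inner_part \<epsilon> \<Omega>")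
  case True
  obtain k where k: "k \<in> inner_cells \<epsilon> \<Omega>" "fst w \<in> cell \<epsilon> k" "cell_index \<epsilon> (fst w) = k"
    "\<forall>j. fst w \<in> cell \<epsilon> j \<longleftrightarrow> j = k"
    using inner_part_memE[OF \<epsilon> True] by blast
  then have "fst w \<in> \<Omega>" by (auto simp: inner_cells_def)
  have "(\<Sum>j\<in>inner_cells \<epsilon> \<Omega>. cell_integrand \<epsilon> j \<psi> \<phi> w) =
      (\<Sum>j\<in>inner_cells \<epsilon> \<Omega>. if j = k then cell_integrand \<epsilon> k \<psi> \<phi> w else 0)"
    by (intro sum.cong) (use k(4) in \<open>auto simp: cell_integrand_def indicator_def mem_Times_iff\<close>)
  also have "\<dots> = cell_integrand \<epsilon> k \<psi> \<phi> w"
    using fin k by simp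
  also have "\<dots> = indicator (\<Omega> \<times> unit_cell) w * (\<phi> w * unfolding_op \<epsilon> \<Omega> \<psi> w)"
    using True k \<open>fst w \<in> \<Omega>\<close>
    by (auto simp: cell_integrand_def unfolding_op_def split_beta cell_map_eq_mult indicator_def mem_Times_iff)
  finally show ?thesis ..
next
  case False
  then have "cell_integrand \<epsilon> k \<psi> \<phi> w = 0" if "k \<in> inner_cells \<epsilon> \<Omega>" for k
    using that by (auto simp: inner_part_def cell_integrand_def indicator_def)
  with False show ?thesis
    by (simp add: unfolding_op_def split_beta)
qed

text \<open>Again only the cell containing \<open>x\<close> contributes. The average is taken over
  \<open>unit_cell\<close> but the summand integrates over the cell itself, and the factor
  \<open>1 / \<epsilon>^4\<close> compensates for this rescaling.\<close>

lemma averaging_op_eq_sum_cells: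
  fixes \<psi> :: "real^3 \<Rightarrow> real"
  assumes \<epsilon>: "\<epsilon> > 0" and fin: "finite (inner_cells \<epsilon> \<Omega>)"
  shows "indicator \<Omega> x * (averaging_op \<epsilon> \<Omega> \<phi> x * \<psi> x) =
    (\<Sum>k\<in>inner_cells \<epsilon> \<Omega>. 1 / (measure lebesgue unit_cell * \<epsilon>^4) *
       (\<integral>z. cell_integrand \<epsilon> k \<psi> \<phi> (z, cell_inv \<epsilon> k x) \<partial>lebesgue))"
    (is "_ = (\<Sum>k\<in>_. ?c * ?g k)")
proof -
  have zero: "?g k = 0" if "x \<notin> cell \<epsilon> k" for k
  proof -
    have "cell_inv \<epsilon> k x \<notin> unit_cell"
      using that \<epsilon> by (simp add: mem_cell_iff cell_inv_def)
    then show ?thesis by (simp add: cell_integrand_def)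
  qed
  show ?thesis
  proof (cases "x \<in> inner_part \<epsilon> \<Omega>")
    case True
    obtain k where k: "k \<in> inner_cells \<epsilon> \<Omega>" "x \<in> cell \<epsilon> k" "cell_index \<epsilon> x = k"
      "\<forall>j. x \<in> cell \<epsilon> j \<longleftrightarrow> j = k"
      using inner_part_memE[OF \<epsilon> True] by blast
    define y where "y = cell_inv \<epsilon> k x"
    have map_y: "cell_map \<epsilon> k y = x"
      using \<epsilon> by (simp add: y_def cell_map_cell_inv)
    have "y \<in> unit_cell"
      using k(2) cell_map_mem_cell_iff[OF \<epsilon>, of k y] map_y by simp
    moreover have "cell_frac \<epsilon> x = y"
      unfolding cell_frac_def k(3) y_def cell_inv_def ..
    ultimately have y: "y \<in> unit_cell" "cell_map \<epsilon> k y = x" "cell_frac \<epsilon> x = y"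
      using map_y by auto
    have "x \<in> \<Omega>" using k by (auto simp: inner_cells_def)
    have "(\<Sum>j\<in>inner_cells \<epsilon> \<Omega>. ?c * ?g j) = (\<Sum>j\<in>inner_cells \<epsilon> \<Omega>. if j = k then ?c * ?g k else 0)"
      by (intro sum.cong) (use k(4) zero in auto)
    also have "\<dots> = ?c * ?g k"
      using fin k by simp
    \<comment> \<open>With the second variable fixed at \<open>y\<close>, the \<psi> factor is
      \<psi> at \<open>cell_map \<epsilon> k y = x\<close>, a constant in \<open>z\<close>.\<close>
    also have "?g k = (\<integral>z. indicator (cell \<epsilon> k) z * \<phi> (z, y) * \<psi> x \<partial>lebesgue)"
      using y by (simp add: cell_integrand_def indicator_times mult.assoc flip: y_def)
    also have "\<dots> = (\<integral>z. indicator (cell \<epsilon> k) z * \<phi> (z, y) \<partial>lebesgue) * \<psi> x"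
      by simp
    also have "(\<integral>z. indicator (cell \<epsilon> k) z * \<phi> (z, y) \<partial>lebesgue) =
        \<epsilon>^4 * (\<integral>z. indicator (cell \<epsilon> k) (cell_map \<epsilon> k z) * \<phi> (cell_map \<epsilon> k z, y) \<partial>lebesgue)"
      by (rule integral_lebesgue_cell_map[OF \<epsilon>, symmetric])
    also have "(\<integral>z. indicator (cell \<epsilon> k) (cell_map \<epsilon> k z) * \<phi> (cell_map \<epsilon> k z, y) \<partial>lebesgue) =
        (\<integral>z. \<phi> (cell_map \<epsilon> k z, y) \<partial>lebesgue_on unit_cell)"
      using \<epsilon> by (simp add: integral_lebesgue_on_eq_mult_indicator[OF unit_cell_lebesgue] indicator_def cell_map_mem_cell_iff)
    finally show ?thesis
      using True k y \<open>x \<in> \<Omega>\<close> \<epsilon> by (simp add: averaging_op_def cell_map_eq_mult)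
  next
    case False
    then have "?g k = 0" if "k \<in> inner_cells \<epsilon> \<Omega>" for k
      using that by (intro zero) (auto simp: inner_part_def)
    with False show ?thesis
      by (simp add: averaging_op_def)
  qed
qed

section \<open>Summation over the cells and comparison of the two sides\<close>

theorem mainTheorem6:
  fixes \<Omega> :: "(real^3) set" and \<epsilon> p q :: real
    and \<psi> :: "real^3 \<Rightarrow> real" and \<phi> :: "(real^3) \<times> (real^3) \<Rightarrow> real"
  assumes "open \<Omega>" and "connected \<Omega>" and "\<Omega> \<noteq> {}" and "bounded \<Omega>"
    and "\<epsilon> > 0"
    and "p > 1" and "q > 1" and "1 / p + 1 / q = 1"
    and "in_Lp p \<Omega> \<psi>"
    and "in_Lp q (\<Omega> \<times> unit_cell) \<phi>"
  shows "integrable (lebesgue_on \<Omega>) (\<lambda>x. averaging_op \<epsilon> \<Omega> \<phi> x * \<psi> x)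
    \<and> integrable (lebesgue_on (\<Omega> \<times> unit_cell)) (\<lambda>w. \<phi> w * unfolding_op \<epsilon> \<Omega> \<psi> w)
    \<and> (\<integral>x. averaging_op \<epsilon> \<Omega> \<phi> x * \<psi> x \<partial>(lebesgue_on \<Omega>))
      = 1 / measure lebesgue unit_cell
        * (\<integral>w. \<phi> w * unfolding_op \<epsilon> \<Omega> \<psi> w \<partial>(lebesgue_on (\<Omega> \<times> unit_cell)))"
proof -
  let ?E = "inner_cells \<epsilon> \<Omega>" and ?m = "measure lebesgue unit_cell"
  let ?G = "\<lambda>k. cell_integrand \<epsilon> k \<psi> \<phi>"
  let ?g = "\<lambda>k y. \<integral>z. ?G k (z, y) \<partial>lebesgue"
  have fin: "finite ?E"
    by (rule finite_inner_cells) fact+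
  have G: "integrable lebesgue (?G k)" if "k \<in> ?E" for k
    by (rule integrable_cell_integrand[where \<Omega> = \<Omega>]) (use assms that in \<open>auto simp: inner_cells_def\<close>)
  have g: "integrable lebesgue (\<lambda>x. ?g k (cell_inv \<epsilon> k x))"
    and g_int: "(\<integral>x. ?g k (cell_inv \<epsilon> k x) \<partial>lebesgue) = \<epsilon>^4 * integral\<^sup>L lebesgue (?G k)" if "k \<in> ?E" for k
  proof -
    \<comment> \<open>Composing with \<open>cell_map \<epsilon> k\<close> cancels
      \<open>cell_inv \<epsilon> k\<close> and leaves the inner Fubini integral; the substitution
      lemma then returns to the variable \<open>x\<close>.\<close>
    have "integrable lebesgue (\<lambda>y. ?g k (cell_inv \<epsilon> k (cell_map \<epsilon> k y)))"
      using integrable_snd_lebesgue[OF G[OF that]] \<open>\<epsilon> > 0\<close> by (simp add: cell_inv_cell_map)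
    then show "integrable lebesgue (\<lambda>x. ?g k (cell_inv \<epsilon> k x))"
      by (subst (asm) integrable_lebesgue_cell_map_iff[OF \<open>\<epsilon> > 0\<close>])
    show "(\<integral>x. ?g k (cell_inv \<epsilon> k x) \<partial>lebesgue) = \<epsilon>^4 * integral\<^sup>L lebesgue (?G k)"
      using integral_lebesgue_cell_map[OF \<open>\<epsilon> > 0\<close>, of "\<lambda>x. ?g k (cell_inv \<epsilon> k x)" k]
        integral_snd_lebesgue[OF G[OF that]] \<open>\<epsilon> > 0\<close> by (simp add: cell_inv_cell_map)
  qed
  have \<Omega>: "\<Omega> \<in> sets lebesgue"
    using \<open>open \<Omega>\<close> by simp
  have "\<Omega> \<times> unit_cell \<in> sets borel"
    using \<open>open \<Omega>\<close> unit_cell_borel by (intro borel_Times) auto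
  then have \<Omega>Y: "\<Omega> \<times> unit_cell \<in> sets lebesgue" by simp
  note avg = averaging_op_eq_sum_cells[OF \<open>\<epsilon> > 0\<close> fin] and unf = unfolding_op_eq_sum_cells[OF \<open>\<epsilon> > 0\<close> fin]
  have "integrable (lebesgue_on \<Omega>) (\<lambda>x. averaging_op \<epsilon> \<Omega> \<phi> x * \<psi> x)"
    unfolding integrable_lebesgue_on_iff_mult_indicator[OF \<Omega>] avg
    by (intro Bochner_Integration.integrable_sum integrable_mult_right g)
  moreover have "integrable (lebesgue_on (\<Omega> \<times> unit_cell)) (\<lambda>w. \<phi> w * unfolding_op \<epsilon> \<Omega> \<psi> w)"
    unfolding integrable_lebesgue_on_iff_mult_indicator[OF \<Omega>Y] unf
    by (intro Bochner_Integration.integrable_sum G)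
  \<comment> \<open>The \<open>\<epsilon>^4\<close> of the outer substitution meets the
    \<open>1 / \<epsilon>^4\<close> of the averaging formula; after cancellation each cell carries
    only the reciprocal of \<open>?m\<close>.\<close>
  moreover have "(\<integral>x. averaging_op \<epsilon> \<Omega> \<phi> x * \<psi> x \<partial>(lebesgue_on \<Omega>)) =
      (\<Sum>k\<in>?E. 1 / (?m * \<epsilon>^4) * (\<epsilon>^4 * integral\<^sup>L lebesgue (?G k)))"
    unfolding integral_lebesgue_on_eq_mult_indicator[OF \<Omega>] avg
    by (subst Bochner_Integration.integral_sum) (auto simp: g g_int intro!: integrable_mult_right)
  moreover have "(\<integral>w. \<phi> w * unfolding_op \<epsilon> \<Omega> \<psi> w \<partial>(lebesgue_on (\<Omega> \<times> unit_cell))) =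
      (\<Sum>k\<in>?E. integral\<^sup>L lebesgue (?G k))"
    unfolding integral_lebesgue_on_eq_mult_indicator[OF \<Omega>Y] unf
    by (intro Bochner_Integration.integral_sum G)
  ultimately show ?thesis
    using \<open>\<epsilon> > 0\<close> by (simp add: sum_distrib_left)
qed

end
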